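(* Let $\mathcal{S}=\{\Sigma_t=({\bf u}_t,{\bf p},\widetilde B_t):t\in\mathbb{T}_r\}$ be a seed pattern of geometric type with extended rank $(r,l)$, fix $t_0\in\mathbb{T}_r$, write ${\bf u}_{t_0}=(u_1,\ldots,u_r)$, and let $0\le s<r$. Let $\mathcal{S}^\diamond$ be the seed pattern of extended rank $(s,r-s+l)$ obtained from $\mathcal{S}$ by freezing $u_{s+1},\ldots,u_r$ in the seed $\Sigma_{t_0}$. Then $\mathcal{A}_{\mathbb Z}(\mathcal{S}^\diamond,\emptyset)\subset\mathcal{A}_{\mathbb Z}(\mathcal{S},\emptyset)$ and the inclusion $\mathcal{A}_{\mathbb Z}(\mathcal{S}^\diamond,\emptyset)\hookrightarrow\mathcal{A}_{\mathbb Z}(\mathcal{S},\emptyset)$ has Property $\mathfrak{F}$.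
   Context: Notation: $[m,n]$ is the set of integers $k$ with $m\le k\le n$; $[a]_+=\max(a,0)$, applied entrywise to integer matrices. For ${\bf a}=(a_1,\dots,a_n)$ and an integer column vector $L=(l_1,\dots,l_n)^T$, ${\bf a}^L=a_1^{l_1}\cdots a_n^{l_n}$. Cluster algebras of geometric type. Let $\mathbb{F}$ be a field of rational functions over $\mathbb{Q}$ in $r+l$ independent variables. A seed of extended rank $(r,l)$ in $\mathbb F$ is $\Sigma=({\bf u},{\bf p},\widetilde B)$, where ${\bf u}=(u_1,\ldots,u_r)$ and ${\bf p}=(p_1,\ldots,p_l)$ together freely generate $\mathbb{F}$ over $\mathbb{Q}$, and $\widetilde B=\binom{B}{P}=(b_{i,j})$ is an $(r+l)\times r$ integer matrix whose top $r\times r$ part $B$ is skew-symmetrizable. With $B_k,P_k$ the $k$th columns of $B,P$, the mutation $\mu_k(\Sigma)=({\bf u}',{\bf p},\widetilde B')$, $k\in[1,r]$, has $u'_j=u_j$ for $j\ne k$, $u_ku_k'={\bf u}^{[B_k]_+}{\bf p}^{[P_k]_+}+{\bf u}^{[-B_k]_+}{\bf p}^{[-P_k]_+}$, and $b'_{i,j}=-b_{i,j}$ if $i=k$ or $j=k$, $b'_{i,j}=b_{i,j}+[b_{i,k}]_+[b_{k,j}]_+-[-b_{i,k}]_+[-b_{k,j}]_+$ otherwise. Let $\mathbb{T}_r$ be the $r$-regular tree with edges at each vertex labelled by $[1,r]$. A seed pattern $\mathcal{S}=\{\Sigma_t:t\in\mathbb{T}_r\}$ assigns seeds to vertices so that $\Sigma_{t'}=\mu_k(\Sigma_t)$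 whenever $t,t'$ are joined by an edge labelled $k$. Entries of the ${\bf u}_t$ are cluster variables, entries of ${\bf p}$ are frozen variables; $\widetilde{\mathfrak X}(\mathcal{S})$ is the set of all of them (extended cluster variables). $\mathcal{A}_{\mathbb Z}(\mathcal{S},\emptyset)\subset\mathbb{F}$ is the subring generated by $\widetilde{\mathfrak X}(\mathcal{S})$. Freezing: $\mathcal{S}^\diamond$ is the seed pattern in the same field $\mathbb{F}$, indexed by $\mathbb{T}_s$, whose seed at $t_0$ has cluster $(u_1,\ldots,u_s)$, frozen variables $(u_{s+1},\ldots,u_r,p_1,\ldots,p_l)$, and extended mutation matrix obtained from $\widetilde B_{t_0}$ by deleting the columns indexed by $[s+1,r]$ (here $\mathbb{T}_s$ is identified with the subtree of $\mathbb{T}_r$ generated by $t_0$ and the edges labelled by $[1,s]$). Property $\mathfrak{F}$: let $\mathcal{A}^+_{\mathbb Z}(\mathcal{S},\emptyset)\subset\mathcal{A}_{\mathbb Z}(\mathcal{S},\emptyset)$ be the semiring (with $1$ but without $0$) generated by $\widetilde{\mathfrak X}(\mathcal{S})$. A ring homomorphism $\psi:\mathcal{A}_{\mathbb Z}(\mathcal{S},\emptyset)\to\mathcal{A}_{\mathbb Z}(\mathcal{S}',\emptyset)$ has Property $\mathfrak{F}$ if $\psi(\widetilde{\mathfrak X}(\mathcal{S}))\subset\mathcal{A}^+_{\mathbb Z}(\mathcal{S}',\emptyset)$. *)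

theory Defs
  imports Main "Jordan_Normal_Form.Matrix"
begin

(* Everything is indexed from 0: the mutation directions of a seed of extended rank (r,l) are the
   k < r.  Clusters are lists, so "u @ p" is the tuple (u_1,...,u_r,p_1,...,p_l), whose entries
   correspond to the rows of the extended mutation matrix.  The ambient field is the whole type
   'a; by "seed" below it is required to be a field of rational functions over the rationals. *)

section \<open>Free generation\<close>

inductive_set subfield_generated :: "'a::field set \<Rightarrow> 'a set" for X where
  incl: "x \<in> X \<Longrightarrow> x \<in> subfield_generated X"
| one: "1 \<in> subfield_generated X"
| plus: "x \<in> subfield_generated X \<Longrightarrow> y \<in> subfield_generated X \<Longrightarrow> x + y \<in> subfield_generated X"
| uminus: "x \<in> subfield_generated X \<Longrightarrow> - x \<in> subfield_generated X"
| times: "x \<in> subfield_generated X \<Longrightarrow> y \<in> subfield_generated X \<Longrightarrow> x * y \<in> subfield_generated X"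
| inverse: "x \<in> subfield_generated X \<Longrightarrow> inverse x \<in> subfield_generated X"

(* Polynomials over the rationals in n variables are given by a finite set A of exponent lists of
   length n and a coefficient function c. *)
definition algebraically_independent :: "'a::field_char_0 list \<Rightarrow> bool" where
  "algebraically_independent xs \<longleftrightarrow>
     (\<forall>A (c :: nat list \<Rightarrow> rat).
        finite A \<and> (\<forall>e\<in>A. length e = length xs) \<and>
        (\<Sum>e\<in>A. of_rat (c e) * (\<Prod>i<length xs. xs ! i ^ (e ! i))) = 0
        \<longrightarrow> (\<forall>e\<in>A. c e = 0))"

(* In characteristic 0 every subfield contains the rationals. *)
definition freely_generates :: "'a::field_char_0 list \<Rightarrow> bool" where
  "freely_generates xs \<longleftrightarrow>
     algebraically_independent xs \<and> subfield_generated (set xs) = UNIV"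

section \<open>Seeds and mutations\<close>

record 'a seed =
  cluster :: "'a list"
  frozen :: "'a list"
  exmat :: "int mat"

definition skew_symmetrizable :: "int mat \<Rightarrow> bool" where
  "skew_symmetrizable B \<longleftrightarrow> square_mat B \<and>
     (\<exists>d :: nat \<Rightarrow> int. (\<forall>i<dim_row B. d i > 0) \<and>
        (\<forall>i<dim_row B. \<forall>j<dim_row B. d i * B $$ (i, j) = - (d j * B $$ (j, i))))"

definition principal_part :: "int mat \<Rightarrow> int mat" where
  "principal_part M = mat (dim_col M) (dim_col M) (\<lambda>(i, j). M $$ (i, j))"

definition is_seed :: "nat \<Rightarrow> nat \<Rightarrow> 'a::field_char_0 seed \<Rightarrow> bool" where
  "is_seed r l \<Sigma> \<longleftrightarrow>
     length (cluster \<Sigma>) = r \<and> length (frozen \<Sigma>) = l \<and>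
     freely_generates (cluster \<Sigma> @ frozen \<Sigma>) \<and>
     exmat \<Sigma> \<in> carrier_mat (r + l) r \<and>
     skew_symmetrizable (principal_part (exmat \<Sigma>))"

definition pos_part :: "int \<Rightarrow> int" where
  "pos_part a = max a 0"

definition monom_pow :: "'a::field list \<Rightarrow> int vec \<Rightarrow> 'a" where
  "monom_pow a L = (\<Prod>i<length a. a ! i powi (L $ i))"

definition mutate_var :: "nat \<Rightarrow> 'a::field_char_0 seed \<Rightarrow> 'a" where
  "mutate_var k \<Sigma> =
     (let x = cluster \<Sigma> @ frozen \<Sigma>; b = col (exmat \<Sigma>) k
      in (monom_pow x (map_vec pos_part b) + monom_pow x (map_vec pos_part (- b)))
           / cluster \<Sigma> ! k)"

definition mutate_mat :: "nat \<Rightarrow> int mat \<Rightarrow> int mat" where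
  "mutate_mat k M = mat (dim_row M) (dim_col M) (\<lambda>(i, j).
     if i = k \<or> j = k then - M $$ (i, j)
     else M $$ (i, j) + pos_part (M $$ (i, k)) * pos_part (M $$ (k, j))
            - pos_part (- M $$ (i, k)) * pos_part (- M $$ (k, j)))"

definition mutate :: "nat \<Rightarrow> 'a::field_char_0 seed \<Rightarrow> 'a seed" where
  "mutate k \<Sigma> = \<lparr> cluster = (cluster \<Sigma>)[k := mutate_var k \<Sigma>],
                  frozen = frozen \<Sigma>,
                  exmat = mutate_mat k (exmat \<Sigma>) \<rparr>"

section \<open>Seed patterns\<close>

(* The r-regular tree: its vertices are the words in {..<r} without equal adjacent letters, and a
   word w is joined to w @ [k] by an edge labelled k. *)
definition reg_tree :: "nat \<Rightarrow> nat list set" where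
  "reg_tree r = {t. set t \<subseteq> {..<r} \<and> distinct_adj t}"

definition tree_edge :: "nat \<Rightarrow> nat list \<Rightarrow> nat list \<Rightarrow> bool" where
  "tree_edge k t t' \<longleftrightarrow> t' = t @ [k] \<or> t = t' @ [k]"

lemma reg_tree_regular:
  assumes "t \<in> reg_tree r" and "k < r"
  shows "\<exists>!t'. t' \<in> reg_tree r \<and> tree_edge k t t'"
proof (cases "t \<noteq> [] \<and> last t = k")
  case True
  then obtain w where w: "t = w @ [k]" by (metis append_butlast_last_id)
  show ?thesis
    using assms unfolding w
    by (intro ex1I[of _ w]) (auto simp: reg_tree_def tree_edge_def distinct_adj_append_iff)
next
  case False
  then show ?thesis
    using assms
    by (intro ex1I[of _ "t @ [k]"])
       (auto simp: reg_tree_def tree_edge_def distinct_adj_append_iff)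
qed

(* The subtree of the r-regular tree generated by t0 and the edges labelled by {..<s}, a copy of
   the s-regular tree. *)
definition subtree :: "nat \<Rightarrow> nat \<Rightarrow> nat list \<Rightarrow> nat list set" where
  "subtree r s t0 =
     {t. (\<lambda>a b. a \<in> reg_tree r \<and> b \<in> reg_tree r \<and> (\<exists>k<s. tree_edge k a b))\<^sup>*\<^sup>* t0 t}"

(* The index set V is either a regular tree or a subtree as above. *)
definition seed_pattern ::
    "nat \<Rightarrow> nat \<Rightarrow> nat list set \<Rightarrow> (nat list \<Rightarrow> 'a::field_char_0 seed) \<Rightarrow> bool" where
  "seed_pattern r l V S \<longleftrightarrow>
     (\<forall>t\<in>V. is_seed r l (S t)) \<and>
     (\<forall>t\<in>V. \<forall>t'\<in>V. \<forall>k<r. tree_edge k t t' \<longrightarrow> S t' = mutate k (S t))"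

definition freeze_seed :: "nat \<Rightarrow> 'a seed \<Rightarrow> 'a seed" where
  "freeze_seed s \<Sigma> = \<lparr> cluster = take s (cluster \<Sigma>),
                      frozen = drop s (cluster \<Sigma>) @ frozen \<Sigma>,
                      exmat = mat (dim_row (exmat \<Sigma>)) s (\<lambda>(i, j). exmat \<Sigma> $$ (i, j)) \<rparr>"

(* S' is the seed pattern obtained from S, of extended rank (r,l), by freezing the cluster
   variables with indices s,...,r-1 of the seed at t0. *)
definition is_freezing ::
    "nat \<Rightarrow> nat \<Rightarrow> nat \<Rightarrow> nat list \<Rightarrow> (nat list \<Rightarrow> 'a::field_char_0 seed) \<Rightarrow>
     (nat list \<Rightarrow> 'a seed) \<Rightarrow> bool" where
  "is_freezing r l s t0 S S' \<longleftrightarrow>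
     seed_pattern s (r - s + l) (subtree r s t0) S' \<and> S' t0 = freeze_seed s (S t0)"

section \<open>Cluster algebras and Property F\<close>

definition ext_cluster_variables :: "nat list set \<Rightarrow> (nat list \<Rightarrow> 'a seed) \<Rightarrow> 'a set" where
  "ext_cluster_variables V S = (\<Union>t\<in>V. set (cluster (S t)) \<union> set (frozen (S t)))"

inductive_set subring_generated :: "'a::ring_1 set \<Rightarrow> 'a set" for X where
  incl: "x \<in> X \<Longrightarrow> x \<in> subring_generated X"
| one: "1 \<in> subring_generated X"
| plus: "x \<in> subring_generated X \<Longrightarrow> y \<in> subring_generated X \<Longrightarrow> x + y \<in> subring_generated X"
| uminus: "x \<in> subring_generated X \<Longrightarrow> - x \<in> subring_generated X"
| times: "x \<in> subring_generated X \<Longrightarrow> y \<in> subring_generated X \<Longrightarrow> x * y \<in> subring_generated X"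

(* Semirings have a 1 but need not have a 0. *)
inductive_set semiring_generated :: "'a::ring_1 set \<Rightarrow> 'a set" for X where
  incl: "x \<in> X \<Longrightarrow> x \<in> semiring_generated X"
| one: "1 \<in> semiring_generated X"
| plus: "x \<in> semiring_generated X \<Longrightarrow> y \<in> semiring_generated X \<Longrightarrow> x + y \<in> semiring_generated X"
| times: "x \<in> semiring_generated X \<Longrightarrow> y \<in> semiring_generated X \<Longrightarrow> x * y \<in> semiring_generated X"

definition cluster_algebra :: "nat list set \<Rightarrow> (nat list \<Rightarrow> 'a::field_char_0 seed) \<Rightarrow> 'a set" where
  "cluster_algebra V S = subring_generated (ext_cluster_variables V S)"

definition cluster_semiring :: "nat list set \<Rightarrow> (nat list \<Rightarrow> 'a::field_char_0 seed) \<Rightarrow> 'a set" where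
  "cluster_semiring V S = semiring_generated (ext_cluster_variables V S)"

definition ring_hom_on :: "('a::ring_1 \<Rightarrow> 'b::ring_1) \<Rightarrow> 'a set \<Rightarrow> 'b set \<Rightarrow> bool" where
  "ring_hom_on \<psi> R R' \<longleftrightarrow> \<psi> ` R \<subseteq> R' \<and> \<psi> 1 = 1 \<and>
     (\<forall>x\<in>R. \<forall>y\<in>R. \<psi> (x + y) = \<psi> x + \<psi> y \<and> \<psi> (x * y) = \<psi> x * \<psi> y)"

definition has_property_F ::
    "('a::field_char_0 \<Rightarrow> 'b::field_char_0) \<Rightarrow> nat list set \<Rightarrow> (nat list \<Rightarrow> 'a seed) \<Rightarrow>
     nat list set \<Rightarrow> (nat list \<Rightarrow> 'b seed) \<Rightarrow> bool" where
  "has_property_F \<psi> V S V' S' \<longleftrightarrow>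
     ring_hom_on \<psi> (cluster_algebra V S) (cluster_algebra V' S') \<and>
     \<psi> ` ext_cluster_variables V S \<subseteq> cluster_semiring V' S'"

section \<open>Freezings exist\<close>

lemma freeze_seed_append:
  "cluster (freeze_seed s \<Sigma>) @ frozen (freeze_seed s \<Sigma>) = cluster \<Sigma> @ frozen \<Sigma>"
  unfolding freeze_seed_def by (metis append_assoc append_take_drop_id seed.select_convs(1,2))

lemma is_seed_freeze_seed:
  assumes "is_seed r l \<Sigma>" and "s \<le> r"
  shows "is_seed s (r - s + l) (freeze_seed s \<Sigma>)"
proof -
  let ?B = "principal_part (exmat \<Sigma>)" and ?B' = "principal_part (exmat (freeze_seed s \<Sigma>))"
  have dims: "dim_row (exmat \<Sigma>) = r + l" "dim_col (exmat \<Sigma>) = r"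
    using assms(1) by (auto simp: is_seed_def)
  have B: "dim_row ?B = r" "dim_row ?B' = s" "square_mat ?B'"
    using dims by (simp_all add: principal_part_def freeze_seed_def)
  have B': "?B' $$ (i, j) = ?B $$ (i, j)" if "i < s" "j < s" for i j
    using dims assms(2) that by (simp add: principal_part_def freeze_seed_def)
  have "skew_symmetrizable ?B"
    using assms(1) by (simp only: is_seed_def)
  then obtain d :: "nat \<Rightarrow> int" where d: "\<forall>i<r. d i > 0"
    "\<forall>i<r. \<forall>j<r. d i * ?B $$ (i, j) = - (d j * ?B $$ (j, i))"
    unfolding skew_symmetrizable_def B by blast
  have "d i * ?B' $$ (i, j) = - (d j * ?B' $$ (j, i))" if "i < s" "j < s" for i j
    unfolding B'[OF that] B'[OF that(2,1)] using d(2) that assms(2) order.strict_trans2 by blast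
  then have "skew_symmetrizable ?B'"
    unfolding skew_symmetrizable_def B using B(3) d(1) assms(2) order.strict_trans2 by blast
  moreover have "freely_generates (cluster (freeze_seed s \<Sigma>) @ frozen (freeze_seed s \<Sigma>))"
    using assms(1) unfolding freeze_seed_append by (simp add: is_seed_def)
  moreover have "exmat (freeze_seed s \<Sigma>) \<in> carrier_mat (s + (r - s + l)) s"
    using dims assms(2) by (auto simp: freeze_seed_def)
  moreover have "length (cluster (freeze_seed s \<Sigma>)) = s"
    and "length (frozen (freeze_seed s \<Sigma>)) = r - s + l"
    using assms by (simp_all add: is_seed_def freeze_seed_def)
  ultimately show ?thesis
    unfolding is_seed_def by blast
qed

lemma freeze_seed_mutate:
  assumes "is_seed r l \<Sigma>" and "s \<le> r" and "k < s"
  shows "freeze_seed s (mutate k \<Sigma>) = mutate k (freeze_seed s \<Sigma>)"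
proof -
  have dims: "dim_row (exmat \<Sigma>) = r + l" "dim_col (exmat \<Sigma>) = r" "length (cluster \<Sigma>) = r"
    using assms(1) by (auto simp: is_seed_def)
  have "col (exmat (freeze_seed s \<Sigma>)) k = col (exmat \<Sigma>) k"
    using dims assms by (intro eq_vecI) (auto simp: freeze_seed_def)
  moreover have "cluster (freeze_seed s \<Sigma>) ! k = cluster \<Sigma> ! k"
    using assms(3) by (simp add: freeze_seed_def)
  ultimately have "mutate_var k (freeze_seed s \<Sigma>) = mutate_var k \<Sigma>"
    by (simp only: mutate_var_def freeze_seed_append)
  moreover have "mat (r + l) s (\<lambda>(i, j). mutate_mat k (exmat \<Sigma>) $$ (i, j))
      = mutate_mat k (mat (r + l) s (\<lambda>(i, j). exmat \<Sigma> $$ (i, j)))"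
    using dims assms(2,3) by (intro eq_matI) (auto simp: mutate_mat_def)
  moreover have "dim_row (mutate_mat k (exmat \<Sigma>)) = r + l"
    using dims by (simp add: mutate_mat_def)
  ultimately show ?thesis
    using dims assms(3) by (simp add: mutate_def freeze_seed_def take_update_swap)
qed

lemma is_freezing_exists:
  assumes S: "seed_pattern r l (reg_tree r) S" and t0: "t0 \<in> reg_tree r" and s: "s < r"
  shows "is_freezing r l s t0 S (\<lambda>t. freeze_seed s (S t))"
proof -
  have sub: "t \<in> reg_tree r" if "t \<in> subtree r s t0" for t
    using that t0 unfolding subtree_def by (auto elim: rtranclp.cases)
  have "is_seed s (r - s + l) (freeze_seed s (S t))" if "t \<in> subtree r s t0" for t
    using S s sub[OF that] by (intro is_seed_freeze_seed) (auto simp: seed_pattern_def)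
  moreover have "freeze_seed s (S t') = mutate k (freeze_seed s (S t))"
    if "t \<in> subtree r s t0" "t' \<in> subtree r s t0" "k < s" "tree_edge k t t'" for t t' k
  proof -
    have "S t' = mutate k (S t)" and "is_seed r l (S t)"
      using S s sub that unfolding seed_pattern_def by (meson order.strict_trans)+
    then show ?thesis
      using s that(3) freeze_seed_mutate[of r l "S t" s k] by simp
  qed
  ultimately show ?thesis
    by (simp add: is_freezing_def seed_pattern_def)
qed

end

theory Submission
  imports Defs
begin

lemma subring_generated_mono:
  assumes "X \<subseteq> Y"
  shows "subring_generated X \<subseteq> subring_generated Y"
proof
  fix x assume "x \<in> subring_generated X"
  then show "x \<in> subring_generated Y"
    by induction (use assms in \<open>auto intro: subring_generated.intros\<close>)
qed

lemma subtree_subset_reg_tree: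
  assumes "t0 \<in> reg_tree r"
  shows "subtree r s t0 \<subseteq> reg_tree r"
  using assms unfolding subtree_def by (auto elim: rtranclp.cases)

text \<open>Both sides agree at \<open>t0\<close> and obey the same mutation rule along edges
  labelled below \<open>s\<close>, so induction on a path from \<open>t0\<close> applies. In
  particular, a freezing is unique on the subtree.\<close>

lemma is_freezing_eq_freeze_seed:
  assumes S: "seed_pattern r l (reg_tree r) S" and "s \<le> r"
    and S': "is_freezing r l s t0 S S'" and t: "t \<in> subtree r s t0"
  shows "S' t = freeze_seed s (S t)"
proof -
  let ?E = "\<lambda>a b. a \<in> reg_tree r \<and> b \<in> reg_tree r \<and> (\<exists>k<s. tree_edge k a b)"
  from t have "?E\<^sup>*\<^sup>* t0 t"
    by (simp add: subtree_def)
  then show ?thesis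
  proof induction
    case base
    show ?case
      using S' by (simp add: is_freezing_def)
  next
    case (step a b)
    then obtain k where ab: "a \<in> reg_tree r" "b \<in> reg_tree r" and k: "k < s" "tree_edge k a b"
      by blast
    \<comment> \<open>The mutation rule for \<open>S'\<close> is available only between vertices of
      its own index set.\<close>
    have "a \<in> subtree r s t0" "b \<in> subtree r s t0"
      using step.hyps rtranclp.rtrancl_into_rtrancl[of ?E] by (auto simp: subtree_def)
    then have "S' b = mutate k (S' a)"
      using S' k unfolding is_freezing_def seed_pattern_def by blast
    also have "\<dots> = freeze_seed s (mutate k (S a))"
      using S ab(1) \<open>s \<le> r\<close> k(1) step.IH freeze_seed_mutate[of r l "S a" s k]
      by (simp add: seed_pattern_def)
    also have "mutate k (S a) = S b"
      using S ab k \<open>s \<le> r\<close> order.strict_trans2 unfolding seed_pattern_def by metis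
    finally show ?case .
  qed
qed

lemma ext_cluster_variables_freezing_subset:
  assumes "seed_pattern r l (reg_tree r) S" and "t0 \<in> reg_tree r" and "s \<le> r"
    and "is_freezing r l s t0 S S'"
  shows "ext_cluster_variables (subtree r s t0) S' \<subseteq> ext_cluster_variables (reg_tree r) S"
proof -
  \<comment> \<open>Freezing moves the point where the list \<open>cluster @ frozen\<close> is
    split, not its entries.\<close>
  have "set (cluster (S' t)) \<union> set (frozen (S' t)) = set (cluster (S t)) \<union> set (frozen (S t))"
    if "t \<in> subtree r s t0" for t
    using is_freezing_eq_freeze_seed[OF assms(1,3,4) that] freeze_seed_append[of s "S t"]
    by (metis set_append)
  then show ?thesis
    using subtree_subset_reg_tree[OF assms(2), of s] unfolding ext_cluster_variables_def by blast
qed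

theorem lemma4p4:
  fixes S S' :: "nat list \<Rightarrow> 'a::field_char_0 seed"
    and r l s :: nat and t0 :: "nat list"
  assumes "seed_pattern r l (reg_tree r) S"
    and "t0 \<in> reg_tree r"
    and "s < r"
    and "is_freezing r l s t0 S S'"
  shows "cluster_algebra (subtree r s t0) S' \<subseteq> cluster_algebra (reg_tree r) S \<and>
         has_property_F (\<lambda>x. x) (subtree r s t0) S' (reg_tree r) S"
proof -
  have X: "ext_cluster_variables (subtree r s t0) S' \<subseteq> ext_cluster_variables (reg_tree r) S"
    using assms by (intro ext_cluster_variables_freezing_subset) auto
  then have "cluster_algebra (subtree r s t0) S' \<subseteq> cluster_algebra (reg_tree r) S"
    unfolding cluster_algebra_def by (rule subring_generated_mono)
  moreover have "ext_cluster_variables (subtree r s t0) S' \<subseteq> cluster_semiring (reg_tree r) S"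
    using X unfolding cluster_semiring_def by (auto intro: semiring_generated.incl)
  ultimately show ?thesis
    by (simp add: has_property_F_def ring_hom_on_def)
qed

end
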